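(* Let $t$ be a positive integer and let $G$ be a finite simple graph with at least one edge and with $|V(G)|\ge t+1$. Then \[\rho(G,K_{1,t})\ \ge\ \frac{t+1}{|V(G)|-\delta_t(G)},\] and equality holds when $t=1$.
   Context: For a finite simple graph $G$ and a positive integer $i$, $\delta_i(G)=\max_S\,(|S|-i|N(S)|)$, where $S$ ranges over all subsets of $V(G)$ and $N(S)$ is the set of vertices having at least one neighbor in $S$. $K_{1,t}$ is the star with $t$ edges (so $K_{1,1}$ is a single edge). A graphon is a symmetric measurable function $W:[0,1]^2\to[0,1]$. For a finite simple graph $G$ with vertices $v_1,\dots,v_n$, put $t(G,W)=\int_{[0,1]^n}\prod_{v_iv_j\in E(G)}W(x_i,x_j)\,dx_1\cdots dx_n$; for a finite graph $W$ (loops allowed), $t(G,W)=\hom(G,W)/|V(W)|^{|V(G)|}$, where $\hom(G,W)$ is the number of maps $V(G)\to V(W)$ sending edges to edges. For finite simple graphs $G,H$, the density domination exponent is $\rho(G,H)=\sup_W \frac{\log t(H,W)}{\log t(G,W)}\in[0,\infty]$, where $W$ ranges over all graphons (equivalently, all finite graphs) with $t(G,W)\ne 0$. Conventions: those $W$ with $t(G,W)=1$, where the quotient is undefined, are omitted; $\log 0=-\infty$, so the quotient is $+\infty$ if $t(H,W)=0$. Thus, when $G$ has at least one edge, for $c>0$ one has $\rho(G,H)\le c$ if and only if $t(H,W)\ge t(G,W)^c$ for every $W$. *)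

theory Defs
  imports "HOL-Analysis.Analysis"
begin

record 'a sgraph =
  verts :: "'a set"
  edges :: "'a set set"

definition fin_simple_graph :: "'a sgraph \<Rightarrow> bool" where
  "fin_simple_graph G \<longleftrightarrow>
     finite (verts G) \<and> (\<forall>e\<in>edges G. e \<subseteq> verts G \<and> card e = 2)"

definition nbhd :: "'a sgraph \<Rightarrow> 'a set \<Rightarrow> 'a set" where
  "nbhd G S = {v \<in> verts G. \<exists>u\<in>S. {u, v} \<in> edges G}"

definition delta :: "nat \<Rightarrow> 'a sgraph \<Rightarrow> int" where
  "delta i G = Max ((\<lambda>S. int (card S) - int i * int (card (nbhd G S))) ` Pow (verts G))"

text \<open>The star with \<open>t\<close> edges; its centre is \<open>0\<close> and its leaves are \<open>1, \<dots>, t\<close>.\<close>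

definition star :: "nat \<Rightarrow> nat sgraph" where
  "star t = \<lparr>verts = {0..t}, edges = (\<lambda>i. {0, i}) ` {1..t}\<rparr>"

definition unit_interval :: "real measure" where
  "unit_interval = restrict_space lborel {0..1}"

text \<open>A graphon is represented by a function on \<open>\<real>\<^sup>2\<close> of which only the values on the unit
  square matter. Measurability is Borel measurability; a Lebesgue measurable graphon agrees
  almost everywhere with a Borel measurable one.\<close>

definition graphon :: "(real \<Rightarrow> real \<Rightarrow> real) \<Rightarrow> bool" where
  "graphon W \<longleftrightarrow>
     (\<lambda>(x, y). W x y) \<in> borel_measurable (unit_interval \<Otimes>\<^sub>M unit_interval) \<and>
     (\<forall>x\<in>{0..1}. \<forall>y\<in>{0..1}. W x y = W y x \<and> 0 \<le> W x y \<and> W x y \<le> 1)"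

text \<open>The factor that an edge \<open>{u, v}\<close> contributes to the integrand. Edges are unordered, so
  this is well defined because \<open>W\<close> is symmetric on the unit square (see the lemma below).\<close>

definition edge_weight :: "(real \<Rightarrow> real \<Rightarrow> real) \<Rightarrow> ('a \<Rightarrow> real) \<Rightarrow> 'a set \<Rightarrow> real" where
  "edge_weight W x e = (THE w. \<exists>u v. e = {u, v} \<and> u \<noteq> v \<and> w = W (x u) (x v))"

lemma edge_weight_eq:
  assumes "graphon W" "x u \<in> {0..1}" "x v \<in> {0..1}" "u \<noteq> v"
  shows "edge_weight W x {u, v} = W (x u) (x v)"
proof -
  have sym: "W (x u) (x v) = W (x v) (x u)"
    using assms unfolding graphon_def by blast
  show ?thesis
    unfolding edge_weight_def
  proof (rule the_equality)
    show "\<exists>u' v'. {u, v} = {u', v'} \<and> u' \<noteq> v' \<and> W (x u) (x v) = W (x u') (x v')"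
      using assms(4) by blast
  next
    fix w
    assume "\<exists>u' v'. {u, v} = {u', v'} \<and> u' \<noteq> v' \<and> w = W (x u') (x v')"
    then show "w = W (x u) (x v)"
      using sym by (auto simp: doubleton_eq_iff)
  qed
qed

definition hom_density :: "'a sgraph \<Rightarrow> (real \<Rightarrow> real \<Rightarrow> real) \<Rightarrow> real" where
  "hom_density G W =
     (\<integral>x. (\<Prod>e\<in>edges G. edge_weight W x e) \<partial>(\<Pi>\<^sub>M v\<in>verts G. unit_interval))"

definition elog :: "real \<Rightarrow> ereal" where
  "elog x = (if x = 0 then - \<infinity> else ereal (ln x))"

text \<open>In \<^typ>\<open>ereal\<close>, \<open>- \<infinity>\<close> divided by a negative real is \<open>\<infinity>\<close>, so the quotient is \<open>\<infinity>\<close> when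
  \<open>hom_density H W = 0\<close>. If \<open>G\<close> has no edges, the supremum is over the empty set.\<close>

definition density_domination_exponent :: "'a sgraph \<Rightarrow> 'b sgraph \<Rightarrow> ereal" where
  "density_domination_exponent G H =
     (SUP W \<in> {W. graphon W \<and> hom_density G W \<noteq> 0 \<and> hom_density G W \<noteq> 1}.
        elog (hom_density H W) / elog (hom_density G W))"

lemma elog_quotient_zero:
  assumes "0 < b" "b < 1"
  shows "elog 0 / elog b = \<infinity>"
  using assms by (simp add: elog_def divide_ereal_def)

end

theory Submission
  imports Defs "HOL-Probability.Infinite_Product_Measure"
begin

text \<open>For the lower bound let \<open>S\<close> attain \<open>\<delta>\<^sub>t(G)\<close> and take the 0-1-valued graphon in which
  \<open>[0, \<epsilon>\<^bsup>t+1\<^esup>]\<close> is joined to everything, \<open>[0, \<epsilon>]\<close> is complete, and there are no other edges. Mapping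
  \<open>N(S) - S\<close> into \<open>[0, \<epsilon>\<^bsup>t+1\<^esup>]\<close>, \<open>S - N(S)\<close> anywhere and all other vertices into \<open>[0, \<epsilon>]\<close> shows that
  \<open>G\<close> has density at least \<open>\<epsilon>\<close> to the power \<open>|V(G)| - \<delta>\<^sub>t(G)\<close>, whereas the star has density at most
  \<open>3 \<epsilon>\<^bsup>t+1\<^esup>\<close>; let \<open>\<epsilon> \<rightarrow> 0\<close>.

  For \<open>t = 1\<close>, the deficiency version of Hall's theorem gives a partial injection \<open>s\<close> on \<open>V(G)\<close>, defined
  on a set \<open>D\<close> of at least \<open>|V(G)| - \<delta>\<^sub>1(G)\<close> vertices, such that \<open>v\<close> is adjacent to \<open>s v\<close>. Then
  \<open>t(G, W)\<close> is at most the integral of the product of the \<open>W(x\<^sub>v, x\<^bsub>s v\<^esub>)\<^bsup>1/2\<^esup>\<close> over \<open>v \<in> D\<close>. As every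
  variable occurs in at most two factors, repeated use of the Cauchy--Schwarz inequality bounds this
  by the product of the \<open>L\<^sup>2\<close> norms, which is \<open>t(K\<^sub>2, W)\<close> to the power \<open>|D|/2\<close>.\<close>

section \<open>Products in which every variable occurs at most twice\<close>

lemma (in prob_space) integrable_unit_bounded:
  fixes f :: "'a \<Rightarrow> real"
  assumes "f \<in> borel_measurable M" "\<And>x. x \<in> space M \<Longrightarrow> f x \<in> {0..1}"
  shows "integrable M f"
  using assms by (intro integrable_const_bound[where B = 1]) auto

lemma (in prob_space) expectation_unit_bounds:
  fixes f :: "'a \<Rightarrow> real"
  assumes "f \<in> borel_measurable M" "\<And>x. x \<in> space M \<Longrightarrow> f x \<in> {0..1}"
  shows "expectation f \<in> {0..1}"
proof -
  have "expectation f \<le> expectation (\<lambda>_. 1)"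
    using assms by (intro integral_mono integrable_unit_bounded) auto
  moreover have "0 \<le> expectation f"
    using assms by (intro Bochner_Integration.integral_nonneg) auto
  ultimately show ?thesis
    by (simp add: prob_space)
qed

lemma finite_product_prob_space_const:
  assumes "prob_space M" "finite I"
  shows "finite_product_prob_space (\<lambda>_. M) I"
proof -
  interpret prob_space M by (rule assms)
  show ?thesis
    by unfold_locales (rule assms)
qed

lemma prod_unit_bounds:
  fixes f :: "'a \<Rightarrow> real"
  assumes "\<And>i. i \<in> A \<Longrightarrow> f i \<in> {0..1}"
  shows "(\<Prod>i\<in>A. f i) \<in> {0..1}"
  using assms by (auto intro: prod_nonneg prod_le_1)

lemma square_unit_bounds: "x\<^sup>2 \<in> {0..1}" if "x \<in> {0..1}" for x :: real
  using that by (simp add: power_le_one)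

text \<open>Cauchy--Schwarz: the expectation of \<open>(s * f x - g x)\<close> squared is a
  quadratic in \<open>s\<close> that is nonnegative everywhere, which bounds its
  discriminant.\<close>

lemma (in prob_space) expectation_mult_le_sqrt:
  fixes f g :: "'a \<Rightarrow> real"
  assumes [measurable]: "f \<in> borel_measurable M" "g \<in> borel_measurable M"
    and f: "\<And>x. x \<in> space M \<Longrightarrow> f x \<in> {0..1}" and g: "\<And>x. x \<in> space M \<Longrightarrow> g x \<in> {0..1}"
  shows "expectation (\<lambda>x. f x * g x)
    \<le> sqrt (expectation (\<lambda>x. (f x)\<^sup>2)) * sqrt (expectation (\<lambda>x. (g x)\<^sup>2))"
proof -
  define a b c where "a = expectation (\<lambda>x. (f x)\<^sup>2)" and "b = expectation (\<lambda>x. (g x)\<^sup>2)"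
    and "c = expectation (\<lambda>x. f x * g x)"
  have int [simp]: "integrable M (\<lambda>x. (f x)\<^sup>2)" "integrable M (\<lambda>x. (g x)\<^sup>2)" "integrable M (\<lambda>x. f x * g x)"
    using f g by (auto intro!: integrable_unit_bounded mult_le_one power_le_one)
  have a0: "a \<ge> 0" and b0: "b \<ge> 0" and c0: "c \<ge> 0"
    using f g by (auto simp: a_def b_def c_def intro!: Bochner_Integration.integral_nonneg)
  have quad: "0 \<le> s\<^sup>2 * a - 2 * s * c + b" for s
  proof -
    have "0 \<le> expectation (\<lambda>x. (s * f x - g x)\<^sup>2)"
      by (intro Bochner_Integration.integral_nonneg) auto
    also have "\<dots> = expectation (\<lambda>x. s\<^sup>2 * (f x)\<^sup>2 - 2 * s * (f x * g x) + (g x)\<^sup>2)"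
      by (simp add: power2_diff power_mult_distrib algebra_simps)
    also have "\<dots> = s\<^sup>2 * a - 2 * s * c + b"
      by (simp add: a_def b_def c_def)
    finally show ?thesis .
  qed
  have "c\<^sup>2 \<le> a * b"
  proof (cases "a = 0")
    case True
    \<comment> \<open>Without the quadratic term, \<open>quad\<close> is linear in \<open>s\<close>;
      at this \<open>s\<close> it would read \<open>0 \<le> -1\<close> if \<open>c\<close> were
      nonzero.\<close>
    have "c = 0"
      using quad[of "(b + 1) / (2 * c)"] True by (cases "c = 0") (auto simp: field_simps)
    then show ?thesis using True by simp
  next
    case False
    with a0 have "a > 0" by simp
    \<comment> \<open>The quadratic attains its minimum at \<open>c / a\<close>.\<close>
    then show ?thesis
      using quad[of "c / a"] by (simp add: field_simps power2_eq_square)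
  qed
  then have "c \<le> sqrt (a * b)"
    using real_le_rsqrt by blast
  then show ?thesis
    by (simp add: a_def b_def c_def real_sqrt_mult)
qed

text \<open>Factors outside \<open>A\<close> are constant, hence equal to their own L2 norm, and can
  be pulled out. The at most two others are handled by Cauchy--Schwarz, a single one being paired
  with the constant 1.\<close>

lemma (in prob_space) expectation_prod_le_two_factors:
  fixes f :: "'e \<Rightarrow> 'a \<Rightarrow> real"
  assumes "finite E" "A \<subseteq> E" "card A \<le> 2"
    and meas: "\<And>e. e \<in> E \<Longrightarrow> f e \<in> borel_measurable M"
    and bnd: "\<And>e x. e \<in> E \<Longrightarrow> x \<in> space M \<Longrightarrow> f e x \<in> {0..1}"
    and const: "\<And>e x y. e \<in> E - A \<Longrightarrow> x \<in> space M \<Longrightarrow> y \<in> space M \<Longrightarrow> f e x = f e y"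
  shows "expectation (\<lambda>x. \<Prod>e\<in>E. f e x) \<le> (\<Prod>e\<in>E. sqrt (expectation (\<lambda>x. (f e x)\<^sup>2)))"
proof -
  obtain x0 where x0: "x0 \<in> space M" using not_empty by blast
  define K where "K = (\<Prod>e\<in>E-A. f e x0)"
  have finA: "finite A" using assms finite_subset by blast
  have split: "(\<Prod>e\<in>E. h e) = (\<Prod>e\<in>A. h e) * (\<Prod>e\<in>E-A. h e)" for h :: "'e \<Rightarrow> real"
    using prod.subset_diff[OF assms(2,1), of h] by (simp add: mult.commute)
  have K0: "K \<ge> 0"
    unfolding K_def using bnd x0 by (intro prod_nonneg) force
  have "(\<Prod>e\<in>E. f e x) = (\<Prod>e\<in>A. f e x) * K" if "x \<in> space M" for x
    unfolding split K_def by (simp only: const[OF _ that x0] cong: prod.cong)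
  then have "expectation (\<lambda>x. \<Prod>e\<in>E. f e x) = expectation (\<lambda>x. (\<Prod>e\<in>A. f e x) * K)"
    by (intro Bochner_Integration.integral_cong) auto
  also have "\<dots> = expectation (\<lambda>x. \<Prod>e\<in>A. f e x) * K"
    by simp
  also have "\<dots> \<le> (\<Prod>e\<in>A. sqrt (expectation (\<lambda>x. (f e x)\<^sup>2))) * K"
  proof (rule mult_right_mono[OF _ K0])
    consider "A = {}" | e where "A = {e}" | e e' where "A = {e, e'}" "e \<noteq> e'"
    proof -
      have "card A = 0 \<or> card A = 1 \<or> card A = 2" using assms(3) by linarith
      then show ?thesis using that finA by (auto simp: card_1_singleton_iff card_2_iff)
    qed
    then show "expectation (\<lambda>x. \<Prod>e\<in>A. f e x) \<le> (\<Prod>e\<in>A. sqrt (expectation (\<lambda>x. (f e x)\<^sup>2)))"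
    proof cases
      case 1 then show ?thesis by (simp add: prob_space)
    next
      case (2 e)
      then have "e \<in> E" using assms by auto
      then show ?thesis
        using 2 expectation_mult_le_sqrt[of "f e" "\<lambda>_. 1"] meas bnd by (simp add: prob_space)
    next
      case (3 e e')
      then have "e \<in> E" "e' \<in> E" using assms by auto
      then show ?thesis
        using 3 expectation_mult_le_sqrt[of "f e" "f e'"] meas bnd by simp
    qed
  qed
  also have "K = (\<Prod>e\<in>E-A. sqrt (expectation (\<lambda>x. (f e x)\<^sup>2)))"
    unfolding K_def
  proof (rule prod.cong[OF refl])
    fix e assume e: "e \<in> E - A"
    have "expectation (\<lambda>x. (f e x)\<^sup>2) = expectation (\<lambda>x. (f e x0)\<^sup>2)"
      by (rule Bochner_Integration.integral_cong[OF refl]) (simp only: const[OF e _ x0])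
    then show "f e x0 = sqrt (expectation (\<lambda>x. (f e x)\<^sup>2))"
      using bnd[of e x0] e x0 by (simp add: prob_space)
  qed
  finally show ?thesis
    by (simp only: split)
qed

text \<open>Integrating out one variable by Cauchy--Schwarz turns each factor into its \<open>L\<^sup>2\<close> norm in that
  variable, which neither changes the total \<open>L\<^sup>2\<close> norms nor creates new dependencies.\<close>

lemma integral_prod_le_two_occurrences:
  fixes M :: "'a measure" and f :: "'e \<Rightarrow> ('i \<Rightarrow> 'a) \<Rightarrow> real" and U :: "'e \<Rightarrow> 'i set"
  assumes M: "prob_space M" and "finite I" and "finite E"
    and "\<And>e. e \<in> E \<Longrightarrow> f e \<in> borel_measurable (\<Pi>\<^sub>M i\<in>I. M)"
    and "\<And>e x. e \<in> E \<Longrightarrow> x \<in> space (\<Pi>\<^sub>M i\<in>I. M) \<Longrightarrow> f e x \<in> {0..1}"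
    and "\<And>e i x y. e \<in> E \<Longrightarrow> i \<in> I - U e \<Longrightarrow> x \<in> space (\<Pi>\<^sub>M i\<in>I. M) \<Longrightarrow> y \<in> space M
      \<Longrightarrow> f e (x(i := y)) = f e x"
    and "\<And>i. i \<in> I \<Longrightarrow> card {e \<in> E. i \<in> U e} \<le> 2"
  shows "(\<integral>x. (\<Prod>e\<in>E. f e x) \<partial>(\<Pi>\<^sub>M i\<in>I. M))
    \<le> (\<Prod>e\<in>E. sqrt (\<integral>x. (f e x)\<^sup>2 \<partial>(\<Pi>\<^sub>M i\<in>I. M)))"
  using assms(2,4-)
proof (induction I arbitrary: f rule: finite_induct)
  case empty
  interpret E: finite_product_prob_space "\<lambda>_. M" "{}"
    using M by (rule finite_product_prob_space_const) simp
  show ?case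
    using empty.prems(1,2) \<open>finite E\<close>
    by (intro E.expectation_prod_le_two_factors[where A = "{}"]) (auto simp: space_PiM)
next
  case (insert i I)
  interpret M: prob_space M by (rule M)
  interpret P: finite_product_prob_space "\<lambda>_. M" "insert i I"
    using M insert.hyps by (intro finite_product_prob_space_const) auto
  interpret Q: finite_product_prob_space "\<lambda>_. M" I
    using M insert.hyps by (intro finite_product_prob_space_const) auto
  let ?I = "\<Pi>\<^sub>M i\<in>I. M"
  define g where "g e x = sqrt (\<integral>y. (f e (x(i := y)))\<^sup>2 \<partial>M)" for e x
  note meas [measurable] = insert.prems(1)
  have upd: "x(i := y) \<in> space (\<Pi>\<^sub>M i\<in>insert i I. M)" if "x \<in> space ?I" "y \<in> space M" for x y
    using that by (auto simp: space_PiM PiE_def extensional_def)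
  have meas_upd: "(\<lambda>p. f e ((fst p)(i := snd p))) \<in> borel_measurable (?I \<Otimes>\<^sub>M M)" if "e \<in> E" for e
    using that by measurable
  have meas1: "(\<lambda>y. f e (x(i := y))) \<in> borel_measurable M" if "e \<in> E" "x \<in> space ?I" for e x
    using measurable_compose[OF measurable_Pair1'[OF that(2)] meas_upd[OF that(1)]] by simp
  have gm [measurable]: "g e \<in> borel_measurable ?I" if "e \<in> E" for e
  proof -
    have "(\<lambda>x. \<integral>y. (f e (x(i := y)))\<^sup>2 \<partial>M) \<in> borel_measurable ?I"
      using meas_upd[OF that]
      by (intro M.borel_measurable_lebesgue_integral) (simp add: case_prod_beta' borel_measurable_power)
    then show ?thesis
      unfolding g_def by measurable
  qed
  have updb: "f e (x(i := y)) \<in> {0..1}" if "e \<in> E" "x \<in> space ?I" "y \<in> space M" for e x y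
    using insert.prems(2)[OF that(1) upd[OF that(2,3)]] .
  have sq1: "(\<integral>y. (f e (x(i := y)))\<^sup>2 \<partial>M) \<in> {0..1}" if "e \<in> E" "x \<in> space ?I" for e x
    using meas1[OF that] updb[OF that]
    by (intro M.expectation_unit_bounds square_unit_bounds borel_measurable_power)
  have gb: "g e x \<in> {0..1}" if "e \<in> E" "x \<in> space ?I" for e x
    using sq1[OF that] by (auto simp: g_def)
  \<comment> \<open>Fubini: taking the L2 norm first in coordinate \<open>i\<close> and then in the
    others gives the full L2 norm.\<close>
  have gsq: "(\<integral>x. (g e x)\<^sup>2 \<partial>?I) = (\<integral>x. (f e x)\<^sup>2 \<partial>(\<Pi>\<^sub>M i\<in>insert i I. M))" if "e \<in> E" for e
  proof -
    have "(\<integral>x. (g e x)\<^sup>2 \<partial>?I) = (\<integral>x. (\<integral>y. (f e (x(i := y)))\<^sup>2 \<partial>M) \<partial>?I)"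
      using sq1[OF that] by (intro Bochner_Integration.integral_cong) (auto simp: g_def)
    also have "\<dots> = (\<integral>x. (f e x)\<^sup>2 \<partial>(\<Pi>\<^sub>M i\<in>insert i I. M))"
      using meas[OF that] insert.prems(2)[OF that] insert.hyps
      by (intro P.product_integral_insert[symmetric] P.integrable_unit_bounded
          square_unit_bounds borel_measurable_power)
    finally show ?thesis .
  qed
  have int: "integrable (\<Pi>\<^sub>M i\<in>insert i I. M) (\<lambda>x. \<Prod>e\<in>E. f e x)"
    using insert.prems(1,2)
    by (intro P.integrable_unit_bounded prod_unit_bounds borel_measurable_prod)
  have intm: "(\<lambda>x. \<integral>y. (\<Prod>e\<in>E. f e (x(i := y))) \<partial>M) \<in> borel_measurable ?I"
    using meas_upd
    by (intro M.borel_measurable_lebesgue_integral) (simp add: case_prod_beta' borel_measurable_prod)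
  have "(\<integral>x. (\<Prod>e\<in>E. f e x) \<partial>(\<Pi>\<^sub>M i\<in>insert i I. M)) = (\<integral>x. (\<integral>y. (\<Prod>e\<in>E. f e (x(i := y))) \<partial>M) \<partial>?I)"
    using int insert.hyps by (intro P.product_integral_insert) auto
  also have "\<dots> \<le> (\<integral>x. (\<Prod>e\<in>E. g e x) \<partial>?I)"
  proof (rule integral_mono)
    show "integrable ?I (\<lambda>x. \<integral>y. (\<Prod>e\<in>E. f e (x(i := y))) \<partial>M)"
      using intm meas1 updb
      by (intro Q.integrable_unit_bounded M.expectation_unit_bounds prod_unit_bounds borel_measurable_prod)
    show "integrable ?I (\<lambda>x. \<Prod>e\<in>E. g e x)"
      using gb gm by (intro Q.integrable_unit_bounded prod_unit_bounds borel_measurable_prod)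
    fix x assume x: "x \<in> space ?I"
    show "(\<integral>y. (\<Prod>e\<in>E. f e (x(i := y))) \<partial>M) \<le> (\<Prod>e\<in>E. g e x)"
      unfolding g_def
    proof (rule M.expectation_prod_le_two_factors[where A = "{e \<in> E. i \<in> U e}"])
      fix e y z assume *: "e \<in> E - {e \<in> E. i \<in> U e}" "y \<in> space M" "z \<in> space M"
      then have "e \<in> E" "i \<in> insert i I - U e" by auto
      from insert.prems(3)[OF this upd[OF x *(3)] *(2)]
      show "f e (x(i := y)) = f e (x(i := z))"
        by (simp only: fun_upd_upd)
    next
      show "card {e \<in> E. i \<in> U e} \<le> 2" by (rule insert.prems(4)) simp
    next
      fix e assume "e \<in> E"
      show "(\<lambda>y. f e (x(i := y))) \<in> borel_measurable M" by (rule meas1) fact+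
    next
      fix e y assume "e \<in> E" "y \<in> space M"
      show "f e (x(i := y)) \<in> {0..1}" by (rule updb) fact+
    qed (use \<open>finite E\<close> in auto)
  qed
  also have "\<dots> \<le> (\<Prod>e\<in>E. sqrt (\<integral>x. (g e x)\<^sup>2 \<partial>?I))"
  proof (rule insert.IH)
    \<comment> \<open>Updates at the distinct coordinates \<open>i\<close> and \<open>j\<close>
      commute, so \<open>g e\<close> inherits from \<open>f e\<close> its independence of the
      coordinates outside \<open>U e\<close>.\<close>
    fix e j x y assume *: "e \<in> E" "j \<in> I - U e" "x \<in> space ?I" "y \<in> space M"
    then have j: "j \<noteq> i" "j \<in> insert i I - U e" using insert.hyps by auto
    have "f e ((x(j := y))(i := z)) = f e (x(i := z))" if "z \<in> space M" for z
      unfolding fun_upd_twist[OF j(1)] by (rule insert.prems(3)[OF *(1) j(2) upd[OF *(3) that] *(4)])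
    then show "g e (x(j := y)) = g e x"
      unfolding g_def
      by (intro arg_cong[where f = sqrt] Bochner_Integration.integral_cong refl) (simp only:)
  next
    show "card {e \<in> E. j \<in> U e} \<le> 2" if "j \<in> I" for j
      by (rule insert.prems(4)) (use that in simp)
  qed (fact gm gb)+
  also have "\<dots> = (\<Prod>e\<in>E. sqrt (\<integral>x. (f e x)\<^sup>2 \<partial>(\<Pi>\<^sub>M i\<in>insert i I. M)))"
    using gsq by (intro prod.cong) auto
  finally show ?case .
qed

section \<open>Hall's theorem\<close>

definition hall_condition :: "'a set \<Rightarrow> ('a \<Rightarrow> 'b set) \<Rightarrow> bool" where
  "hall_condition V A \<longleftrightarrow> (\<forall>S\<subseteq>V. card S \<le> card (\<Union>(A ` S)))"

text \<open>Rado's proof: as long as some \<open>A u\<close> has two elements, one of them can be deleted. Otherwise there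
  are sets \<open>S\<close>, \<open>T\<close> violating the condition after either deletion, and counting \<open>S \<union> T \<union> {u}\<close> and
  \<open>S \<inter> T\<close> gives a contradiction.\<close>

lemma hall_condition_remove:
  assumes "finite V" and fin: "\<And>v. v \<in> V \<Longrightarrow> finite (A v)" and hall: "hall_condition V A"
    and u: "u \<in> V" and xy: "x \<in> A u" "y \<in> A u" "x \<noteq> y"
  shows "hall_condition V (A(u := A u - {x})) \<or> hall_condition V (A(u := A u - {y}))"
proof (rule ccontr)
  \<comment> \<open>A violating set must contain \<open>u\<close>, since otherwise it would already
    violate the condition for \<open>A\<close>. Removing \<open>u\<close> from it lowers its
    cardinality by one and turns the strict inequality into a weak one.\<close>
  have violating: "\<exists>S\<subseteq>V - {u}. card (\<Union>(A ` S) \<union> (A u - {z})) \<le> card S"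
    if violated: "\<not> hall_condition V (A(u := A u - {z}))" for z
  proof -
    let ?A = "A(u := A u - {z})"
    obtain S where S: "S \<subseteq> V" "card (\<Union>(?A ` S)) < card S"
      using violated unfolding hall_condition_def by (meson not_le)
    have "u \<in> S"
    proof (rule ccontr)
      assume "u \<notin> S"
      then have "?A ` S = A ` S" by (intro image_cong) auto
      then show False using S hall unfolding hall_condition_def by (metis not_le)
    qed
    have "?A ` (S - {u}) = A ` (S - {u})" by (intro image_cong) auto
    moreover have "S = insert u (S - {u})" using \<open>u \<in> S\<close> by blast
    ultimately have "?A ` S = insert (A u - {z}) (A ` (S - {u}))"
      by (metis fun_upd_same image_insert)
    then have "\<Union>(?A ` S) = \<Union>(A ` (S - {u})) \<union> (A u - {z})" by auto
    moreover have "card S = Suc (card (S - {u}))"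
      using \<open>u \<in> S\<close> S(1) \<open>finite V\<close> by (meson card.remove finite_subset)
    ultimately show ?thesis using S by (intro exI[of _ "S - {u}"]) auto
  qed
  assume "\<not> ?thesis"
  then obtain S T where S: "S \<subseteq> V - {u}" "card (\<Union>(A ` S) \<union> (A u - {x})) \<le> card S"
    and T: "T \<subseteq> V - {u}" "card (\<Union>(A ` T) \<union> (A u - {y})) \<le> card T"
    using violating by meson
  let ?B = "\<Union>(A ` S) \<union> (A u - {x})" and ?C = "\<Union>(A ` T) \<union> (A u - {y})"
  have finST: "finite S" "finite T" using S T \<open>finite V\<close> by (meson finite_Diff finite_subset)+
  have "finite (A v)" if "v \<in> insert u (S \<union> T)" for v
    using that S(1) T(1) u by (intro fin) auto
  then have finBC: "finite ?B" "finite ?C" using finST by simp_all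
  have hallD: "card X \<le> card (\<Union>(A ` X))" if "X \<subseteq> V" for X
    using hall that unfolding hall_condition_def by simp
  have "card (insert u (S \<union> T)) \<le> card (\<Union>(A ` insert u (S \<union> T)))"
    using S(1) T(1) u by (intro hallD) auto
  \<comment> \<open>As \<open>x \<noteq> y\<close>, each of the two deleted elements survives in the
    other set, so all of \<open>A u\<close> is covered.\<close>
  also have "\<Union>(A ` insert u (S \<union> T)) = ?B \<union> ?C" using xy by auto
  finally have 1: "Suc (card (S \<union> T)) \<le> card (?B \<union> ?C)"
    using S(1) T(1) finST by (subst (asm) card_insert_disjoint) auto
  have "card (S \<inter> T) \<le> card (\<Union>(A ` (S \<inter> T)))"
    using S(1) T(1) by (intro hallD) auto
  also have "\<dots> \<le> card (?B \<inter> ?C)" using finBC by (intro card_mono) auto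
  \<comment> \<open>The cardinalities of \<open>?B\<close> and \<open>?C\<close> add up to at most
    \<open>card S + card T\<close>, but their union and intersection force at least one
    more.\<close>
  finally show False
    using 1 S(2) T(2) card_Un_Int[OF finBC] card_Un_Int[OF finST] by linarith
qed

text \<open>Induction on the total size of the sets: elements are deleted until every set is a
  singleton. The choice is then forced, and the condition for two-element sets makes it
  injective.\<close>

lemma hall_marriage:
  assumes "finite V" "\<And>v. v \<in> V \<Longrightarrow> finite (A v)" "hall_condition V A"
  shows "\<exists>f. inj_on f V \<and> (\<forall>v\<in>V. f v \<in> A v)"
  using assms(2,3)
proof (induction "\<Sum>v\<in>V. card (A v)" arbitrary: A rule: less_induct)
  case less
  note fin = less.prems(1) and hall = less.prems(2)
  show ?case
  proof (cases "\<exists>u\<in>V. \<exists>x\<in>A u. \<exists>y\<in>A u. x \<noteq> y")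
    case True
    then obtain u x y where u: "u \<in> V" "x \<in> A u" "y \<in> A u" "x \<noteq> y" by blast
    obtain z where z: "z \<in> A u" "hall_condition V (A(u := A u - {z}))"
      using hall_condition_remove[OF \<open>finite V\<close> fin hall u] u by blast
    let ?A = "A(u := A u - {z})"
    have "(\<Sum>v\<in>V. card (?A v)) < (\<Sum>v\<in>V. card (A v))"
    proof (rule sum_strict_mono_ex1[OF \<open>finite V\<close>])
      show "\<forall>v\<in>V. card (?A v) \<le> card (A v)" using fin by (auto intro: card_mono)
      show "\<exists>v\<in>V. card (?A v) < card (A v)"
        using card_Diff1_less[OF fin[OF u(1)] z(1)] u(1) by (intro bexI[of _ u]) auto
    qed
    then obtain f where "inj_on f V" "\<forall>v\<in>V. f v \<in> ?A v"
      using less.hyps[of ?A] fin z by (metis finite_Diff fun_upd_apply)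
    then show ?thesis
      by (intro exI[of _ f]) (auto split: if_splits)
  next
    case False
    have "\<exists>x. A v = {x}" if "v \<in> V" for v
    proof -
      have "card {v} \<le> card (\<Union>(A ` {v}))"
        using hall that unfolding hall_condition_def by blast
      then have "A v \<noteq> {}" by auto
      then show ?thesis using False that by blast
    qed
    then obtain f where f: "\<And>v. v \<in> V \<Longrightarrow> A v = {f v}" by metis
    have "inj_on f V"
    proof (rule inj_onI, rule ccontr)
      fix v w assume "v \<in> V" "w \<in> V" "f v = f w" "v \<noteq> w"
      then show False
        using hall f unfolding hall_condition_def by (auto dest: spec[of _ "{v, w}"])
    qed
    then show ?thesis using f by (intro exI[of _ f]) auto
  qed
qed

text \<open>The deficiency version reduces to Hall's theorem by adding \<open>d\<close> elements to every set.\<close>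

lemma hall_deficiency:
  assumes "finite V" and fin: "\<And>v. v \<in> V \<Longrightarrow> finite (A v)"
    and def: "\<And>S. S \<subseteq> V \<Longrightarrow> card S \<le> card (\<Union>(A ` S)) + d"
  shows "\<exists>D f. D \<subseteq> V \<and> card V \<le> card D + d \<and> inj_on f D \<and> (\<forall>v\<in>D. f v \<in> A v)"
proof -
  \<comment> \<open>The \<open>d\<close> new elements are the same for every \<open>v\<close>, so
    they enlarge the union over any nonempty \<open>S\<close> by exactly \<open>d\<close>.\<close>
  define A' where "A' v = Inl ` A v \<union> Inr ` {..<d}" for v
  have "hall_condition V A'"
    unfolding hall_condition_def
  proof (intro allI impI)
    fix S assume S: "S \<subseteq> V"
    show "card S \<le> card (\<Union>(A' ` S))"
    proof (cases "S = {}")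
      case False
      then have "\<Union>(A' ` S) = \<Union>(A ` S) <+> {..<d}"
        by (auto simp: A'_def Plus_def)
      moreover have "finite (\<Union>(A ` S))"
        using S fin \<open>finite V\<close> by (meson finite_UN finite_subset subsetD)
      ultimately show ?thesis
        using def[OF S] by (simp add: card_Plus)
    qed simp
  qed
  then obtain f where f: "inj_on f V" "\<And>v. v \<in> V \<Longrightarrow> f v \<in> A' v"
    using hall_marriage[of V A'] fin \<open>finite V\<close> by (auto simp: A'_def)
  \<comment> \<open>These vertices are matched to genuine elements; the others inject into the
    \<open>d\<close> new ones, so at most \<open>d\<close> are lost.\<close>
  define D where "D = {v \<in> V. f v \<in> range Inl}"
  have "f ` (V - D) \<subseteq> Inr ` {..<d}"
    using f(2) by (fastforce simp: D_def A'_def)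
  moreover have "inj_on f (V - D)" using f(1) by (rule inj_on_subset) auto
  ultimately have "card (V - D) \<le> card (Inr ` {..<d} :: ('b + nat) set)"
    by (intro card_inj_on_le) auto
  also have "\<dots> \<le> d" by (metis card_image_le card_lessThan finite_lessThan)
  finally have "card V \<le> card D + d"
    using \<open>finite V\<close> by (subst (asm) card_Diff_subset) (auto simp: D_def)
  moreover have "inj_on (projl \<circ> f) D"
    using f(1) by (auto simp: inj_on_def D_def)
  moreover have "(projl \<circ> f) v \<in> A v" if "v \<in> D" for v
    using that f(2)[of v] by (auto simp: D_def A'_def)
  ultimately show ?thesis
    by (intro exI[of _ D] exI[of _ "projl \<circ> f"]) (auto simp: D_def)
qed

section \<open>Homomorphism densities\<close>

lemma space_unit_interval [simp]: "space unit_interval = {0..1}"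
  by (simp add: unit_interval_def space_restrict_space)

lemma sets_unit_interval: "A \<in> sets borel \<Longrightarrow> A \<subseteq> {0..1} \<Longrightarrow> A \<in> sets unit_interval"
  by (auto simp: unit_interval_def sets_restrict_space_iff)

lemma measure_unit_interval: "A \<subseteq> {0..1} \<Longrightarrow> measure unit_interval A = measure lborel A"
  by (simp add: unit_interval_def measure_restrict_space)

lemma prob_space_unit_interval: "prob_space unit_interval"
  by (rule prob_spaceI) (simp add: unit_interval_def emeasure_restrict_space space_restrict_space)

lemma measurable_unit_interval_Iic [measurable]: "(\<lambda>x. x \<le> a) \<in> measurable unit_interval (count_space UNIV)"
  unfolding unit_interval_def by (rule measurable_restrict_space1) measurable

abbreviation cube :: "'a set \<Rightarrow> ('a \<Rightarrow> real) measure" where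
  "cube V \<equiv> \<Pi>\<^sub>M v\<in>V. unit_interval"

lemma finite_product_prob_space_cube:
  "finite V \<Longrightarrow> finite_product_prob_space (\<lambda>_. unit_interval) V"
  by (rule finite_product_prob_space_const[OF prob_space_unit_interval])

lemma prob_space_cube: "finite V \<Longrightarrow> prob_space (cube V)"
  by (intro prob_space_PiM prob_space_unit_interval)

lemma space_cubeD: "x \<in> space (cube V) \<Longrightarrow> v \<in> V \<Longrightarrow> x v \<in> {0..1}"
  by (auto simp: space_PiM)

lemma box_in_sets_cube:
  assumes "finite V" "\<And>v. v \<in> V \<Longrightarrow> B v \<in> sets borel" "\<And>v. v \<in> V \<Longrightarrow> B v \<subseteq> {0..1}"
  shows "PiE V B \<in> sets (cube V)"
  using assms by (intro sets_PiM_I_finite sets_unit_interval)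

lemma measure_box:
  assumes "finite V" "\<And>v. v \<in> V \<Longrightarrow> B v \<in> sets borel" "\<And>v. v \<in> V \<Longrightarrow> B v \<subseteq> {0..1}"
  shows "measure (cube V) (PiE V B) = (\<Prod>v\<in>V. measure lborel (B v))"
proof -
  interpret finite_product_prob_space "\<lambda>_. unit_interval" V
    using assms(1) by (rule finite_product_prob_space_cube)
  show ?thesis
    using assms by (subst prob_times) (auto simp: sets_unit_interval measure_unit_interval intro!: prod.cong)
qed

lemma finite_verts: "fin_simple_graph G \<Longrightarrow> finite (verts G)"
  by (simp add: fin_simple_graph_def)

lemma finite_edges: "fin_simple_graph G \<Longrightarrow> finite (edges G)"
  by (auto simp: fin_simple_graph_def intro: finite_subset[of _ "Pow (verts G)"])

lemma edgeE:
  assumes "fin_simple_graph G" "e \<in> edges G"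
  obtains u v where "e = {u, v}" "u \<noteq> v" "u \<in> verts G" "v \<in> verts G"
proof -
  have "e \<subseteq> verts G" "card e = 2" using assms by (auto simp: fin_simple_graph_def)
  then show ?thesis using that by (auto simp: card_2_iff)
qed

section \<open>Edge weights and densities of a fixed graphon\<close>

context
  fixes W :: "real \<Rightarrow> real \<Rightarrow> real"
  assumes W: "graphon W"
begin

lemma edge_weight_bounds:
  assumes "u \<noteq> v" "x u \<in> {0..1}" "x v \<in> {0..1}"
  shows "edge_weight W x {u, v} \<in> {0..1}"
  using assms W by (auto simp: edge_weight_eq graphon_def)

lemma edge_weight_measurable:
  assumes "u \<noteq> v" "u \<in> V" "v \<in> V"
  shows "(\<lambda>x. edge_weight W x {u, v}) \<in> borel_measurable (cube V)"
proof -
  have "(\<lambda>x. (x u, x v)) \<in> measurable (cube V) (unit_interval \<Otimes>\<^sub>M unit_interval)"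
    using assms by (intro measurable_Pair measurable_component_singleton)
  moreover have "(\<lambda>(x, y). W x y) \<in> borel_measurable (unit_interval \<Otimes>\<^sub>M unit_interval)"
    using W by (simp add: graphon_def)
  ultimately have "(\<lambda>x. W (x u) (x v)) \<in> borel_measurable (cube V)"
    using measurable_compose by fastforce
  moreover have "edge_weight W x {u, v} = W (x u) (x v)" if "x \<in> space (cube V)" for x
    using space_cubeD[OF that assms(2)] space_cubeD[OF that assms(3)] by (rule edge_weight_eq[OF W]) fact
  ultimately show ?thesis
    by (simp cong: measurable_cong)
qed

text \<open>Serves two purposes: with an injection \<open>f\<close> it transfers the edge of the
  star to an edge of \<open>G\<close>, and with the identity it shows that coordinates off an edge
  do not influence its weight.\<close>

lemma edge_weight_reindex:
  assumes "u \<noteq> v" "f u \<noteq> f v" "x u \<in> {0..1}" "x v \<in> {0..1}" "y (f u) = x u" "y (f v) = x v"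
  shows "edge_weight W x {u, v} = edge_weight W y {f u, f v}"
  using assms W by (simp add: edge_weight_eq)

context
  fixes G :: "'a sgraph"
  assumes G: "fin_simple_graph G"
begin

lemma edge_weight_bounds_cube:
  assumes "e \<in> edges G" "x \<in> space (cube (verts G))"
  shows "edge_weight W x e \<in> {0..1}"
  using G assms(1)
proof (rule edgeE)
  fix u v assume "e = {u, v}" "u \<noteq> v" "u \<in> verts G" "v \<in> verts G"
  then show ?thesis
    using edge_weight_bounds[of u v x] space_cubeD[OF assms(2)] by simp
qed

lemma edge_weight_measurable_cube:
  assumes "e \<in> edges G"
  shows "(\<lambda>x. edge_weight W x e) \<in> borel_measurable (cube (verts G))"
  using G assms by (rule edgeE) (simp add: edge_weight_measurable)

lemma weight_prod_bounds:
  "x \<in> space (cube (verts G)) \<Longrightarrow> (\<Prod>e\<in>edges G. edge_weight W x e) \<in> {0..1}"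
  by (intro prod_unit_bounds edge_weight_bounds_cube)

lemma weight_prod_measurable:
  "(\<lambda>x. \<Prod>e\<in>edges G. edge_weight W x e) \<in> borel_measurable (cube (verts G))"
  by (intro borel_measurable_prod edge_weight_measurable_cube)

lemma weight_prod_integrable:
  "integrable (cube (verts G)) (\<lambda>x. \<Prod>e\<in>edges G. edge_weight W x e)"
  by (rule prob_space.integrable_unit_bounded[OF prob_space_cube[OF finite_verts[OF G]]
        weight_prod_measurable weight_prod_bounds])

lemma hom_density_bounds: "hom_density G W \<in> {0..1}"
  unfolding hom_density_def
  by (rule prob_space.expectation_unit_bounds[OF prob_space_cube[OF finite_verts[OF G]]
        weight_prod_measurable weight_prod_bounds])

text \<open>The value of the integral on the left is the same for all edges, as \<open>(x u, x v)\<close> is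
  uniformly distributed on the unit square.\<close>

lemma integral_edge_weight:
  assumes e: "{u, v} \<in> edges G"
  shows "(\<integral>x. edge_weight W x {u, v} \<partial>cube (verts G)) = hom_density (star 1) W"
proof -
  have uv: "u \<noteq> v" "u \<in> verts G" "v \<in> verts G"
    using G e by (auto simp: fin_simple_graph_def)
  define f :: "nat \<Rightarrow> 'a" where "f n = (if n = 0 then u else v)" for n
  let ?r = "\<lambda>x. \<lambda>n\<in>{0..1}. x (f n)"
  have verts: "verts (star 1) = {0..1}" and edges: "edges (star 1) = {{0, 1}}"
    by (auto simp: star_def)
  have r: "?r \<in> measurable (cube (verts G)) (cube {0..1})"
    using uv by (intro measurable_restrict measurable_component_singleton) (auto simp: f_def)
  \<comment> \<open>Selecting distinct coordinates of a uniform point of the cube gives a uniform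
    point of the smaller cube.\<close>
  have "distr (cube (verts G)) (cube {0..1}) ?r = cube {0..1}"
    using uv by (intro distr_PiM_reindex prob_space_unit_interval) (auto simp: f_def inj_on_def)
  then have "hom_density (star 1) W
      = (\<integral>x. edge_weight W x {0, 1} \<partial>distr (cube (verts G)) (cube {0..1}) ?r)"
    unfolding hom_density_def verts edges by simp
  also have "\<dots> = (\<integral>x. edge_weight W (?r x) {0, 1} \<partial>cube (verts G))"
    by (rule integral_distr[OF r edge_weight_measurable]) simp_all
  also have "\<dots> = (\<integral>x. edge_weight W x {u, v} \<partial>cube (verts G))"
  proof (intro Bochner_Integration.integral_cong refl)
    fix x assume "x \<in> space (cube (verts G))"
    from space_cubeD[OF this uv(2)] space_cubeD[OF this uv(3)]
    show "edge_weight W (?r x) {0, 1} = edge_weight W x {u, v}"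
      using edge_weight_reindex[of 0 1 f "?r x" x] uv(1) by (simp add: f_def)
  qed
  finally show ?thesis ..
qed

text \<open>The square roots appear because an edge is of the form \<open>{v, s v}\<close> for up to two \<open>v \<in> D\<close>.\<close>

lemma hom_density_le_matching:
  assumes D: "D \<subseteq> verts G" and inj: "inj_on s D" and s: "\<And>v. v \<in> D \<Longrightarrow> {v, s v} \<in> edges G"
  shows "hom_density G W \<le> sqrt (hom_density (star 1) W) ^ card D"
proof -
  have finD: "finite D" using D finite_verts[OF G] finite_subset by blast
  define h where "h v x = sqrt (edge_weight W x {v, s v})" for v x
  have hm: "h v \<in> borel_measurable (cube (verts G))" if "v \<in> D" for v
    unfolding h_def using edge_weight_measurable_cube[OF s[OF that]] by measurable
  have hb: "h v x \<in> {0..1}" if "v \<in> D" "x \<in> space (cube (verts G))" for v x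
    unfolding h_def using edge_weight_bounds_cube[OF s[OF that(1)] that(2)] by simp
  have le: "(\<Prod>e\<in>edges G. edge_weight W x e) \<le> (\<Prod>v\<in>D. h v x)" if x: "x \<in> space (cube (verts G))" for x
  proof -
    let ?F = "\<lambda>e. {v \<in> D. {v, s v} = e}"
    \<comment> \<open>Every \<open>v\<close> in \<open>?F e\<close> is an endpoint of
      \<open>e\<close>, so the right side is a power of the root of the weight with exponent at most
      2. Since the weight lies in \<open>[0, 1]\<close>, that power is at least the weight itself;
      for an edge that is not hit it is 1.\<close>
    have "edge_weight W x e \<le> (\<Prod>v\<in>?F e. h v x)" if e: "e \<in> edges G" for e
    proof -
      have "card e = 2" using G e by (simp add: fin_simple_graph_def)
      moreover from this have "finite e" by (metis card.infinite zero_neq_numeral)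
      ultimately have "card (?F e) \<le> 2"
        using card_mono[of e "?F e"] by auto
      moreover have w: "edge_weight W x e \<in> {0..1}" using edge_weight_bounds_cube[OF e x] .
      ultimately have "sqrt (edge_weight W x e) ^ 2 \<le> sqrt (edge_weight W x e) ^ card (?F e)"
        by (intro power_decreasing) auto
      then show ?thesis using w by (simp add: h_def)
    qed
    then have "(\<Prod>e\<in>edges G. edge_weight W x e) \<le> (\<Prod>e\<in>edges G. \<Prod>v\<in>?F e. h v x)"
      using edge_weight_bounds_cube[OF _ x] by (intro prod_mono) auto
    also have "\<dots> = (\<Prod>v\<in>D. h v x)"
      using s by (intro prod.group finD finite_edges[OF G]) auto
    finally show ?thesis .
  qed
  have "hom_density G W \<le> (\<integral>x. (\<Prod>v\<in>D. h v x) \<partial>cube (verts G))"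
    unfolding hom_density_def
  proof (rule integral_mono[OF weight_prod_integrable _ le])
    show "integrable (cube (verts G)) (\<lambda>x. \<Prod>v\<in>D. h v x)"
      using hm hb
      by (intro prob_space.integrable_unit_bounded[OF prob_space_cube[OF finite_verts[OF G]]]
          borel_measurable_prod prod_unit_bounds)
  qed
  also have "\<dots> \<le> (\<Prod>v\<in>D. sqrt (\<integral>x. (h v x)\<^sup>2 \<partial>cube (verts G)))"
  proof (rule integral_prod_le_two_occurrences[where U = "\<lambda>v. {v, s v}",
        OF prob_space_unit_interval finite_verts[OF G] finD hm hb])
    fix v i x y assume v: "v \<in> D" and i: "i \<in> verts G - {v, s v}"
      and x: "x \<in> space (cube (verts G))" and "y \<in> space unit_interval"
    obtain a b where ab: "{v, s v} = {a, b}" "a \<noteq> b" "a \<in> verts G" "b \<in> verts G"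
      using G s[OF v] by (rule edgeE)
    then have "edge_weight W x {a, b} = edge_weight W (x(i := y)) {a, b}"
      using i space_cubeD[OF x] by (intro edge_weight_reindex[where f = id, simplified]) auto
    then show "h v (x(i := y)) = h v x"
      by (simp only: h_def ab)
  next
    fix i
    \<comment> \<open>Coordinate \<open>i\<close> occurs in the factor of \<open>i\<close> itself
      and, by injectivity of \<open>s\<close>, in at most one factor as a value of
      \<open>s\<close>.\<close>
    have "card {v \<in> D. s v = i} \<le> 1"
      using finD inj by (auto simp: card_le_Suc0_iff_eq inj_on_def)
    moreover have "{v \<in> D. i \<in> {v, s v}} \<subseteq> insert i {v \<in> D. s v = i}" by auto
    then have "card {v \<in> D. i \<in> {v, s v}} \<le> card (insert i {v \<in> D. s v = i})"
      using finD by (intro card_mono) auto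
    moreover have "card (insert i {v \<in> D. s v = i}) \<le> Suc (card {v \<in> D. s v = i})"
      by (rule card_insert_le_m1) auto
    ultimately show "card {v \<in> D. i \<in> {v, s v}} \<le> 2" by linarith
  qed
  also have "\<dots> = (\<Prod>v\<in>D. sqrt (hom_density (star 1) W))"
  proof (intro prod.cong refl arg_cong[where f = sqrt])
    fix v assume v: "v \<in> D"
    have "(\<integral>x. (h v x)\<^sup>2 \<partial>cube (verts G)) = (\<integral>x. edge_weight W x {v, s v} \<partial>cube (verts G))"
      using edge_weight_bounds_cube[OF s[OF v]]
      by (intro Bochner_Integration.integral_cong) (auto simp: h_def)
    then show "(\<integral>x. (h v x)\<^sup>2 \<partial>cube (verts G)) = hom_density (star 1) W"
      using integral_edge_weight[OF s[OF v]] by simp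
  qed
  finally show ?thesis by simp
qed

end

end

section \<open>Deficiency and partial matchings\<close>

lemma delta_ge:
  assumes "fin_simple_graph G" "S \<subseteq> verts G"
  shows "int (card S) - int i * int (card (nbhd G S)) \<le> delta i G"
  unfolding delta_def using assms by (intro Max_ge) (auto simp: fin_simple_graph_def)

lemma delta_attained:
  assumes "fin_simple_graph G"
  obtains S where "S \<subseteq> verts G" "delta i G = int (card S) - int i * int (card (nbhd G S))"
proof -
  have "delta i G \<in> (\<lambda>S. int (card S) - int i * int (card (nbhd G S))) ` Pow (verts G)"
    unfolding delta_def using assms by (intro Max_in) (auto simp: fin_simple_graph_def)
  then show ?thesis using that by auto
qed

lemma delta_nonneg: "fin_simple_graph G \<Longrightarrow> 0 \<le> delta i G"
  using delta_ge[of G "{}" i] by (simp add: nbhd_def)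

text \<open>Makes the denominator of the exponent positive. A proper subset of the vertices is too
  small by itself, and the full vertex set has a nonempty neighbourhood because there is an
  edge.\<close>

lemma delta_less_card_verts:
  assumes G: "fin_simple_graph G" and "edges G \<noteq> {}" "i \<ge> 1"
  shows "delta i G < int (card (verts G))"
proof -
  obtain S where S: "S \<subseteq> verts G" "delta i G = int (card S) - int i * int (card (nbhd G S))"
    using delta_attained[OF G] .
  show ?thesis
  proof (cases "S = verts G")
    case True
    obtain e where e: "e \<in> edges G" using assms(2) by blast
    obtain u v where "e = {u, v}" "u \<noteq> v" "u \<in> verts G" "v \<in> verts G"
      using edgeE[OF G e] .
    then have "v \<in> nbhd G S" using True e by (auto simp: nbhd_def)
    moreover have "finite (nbhd G S)" using finite_verts[OF G] by (simp add: nbhd_def)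
    ultimately have "card (nbhd G S) > 0" by (auto simp: card_gt_0_iff)
    then have "int i * int (card (nbhd G S)) > 0" using assms(3) by simp
    then show ?thesis using S True by simp
  next
    case False
    then have "card S < card (verts G)" using S finite_verts[OF G] by (intro psubset_card_mono) auto
    then show ?thesis using S(2) by (smt (verit) mult_nonneg_nonneg of_nat_0_le_iff of_nat_less_iff)
  qed
qed

text \<open>Hall's theorem in the bipartite double cover of \<open>G\<close>.\<close>

lemma partial_matching_exists:
  assumes G: "fin_simple_graph G"
  obtains D s where "D \<subseteq> verts G" "int (card (verts G)) - delta 1 G \<le> int (card D)" "inj_on s D"
    "\<And>v. v \<in> D \<Longrightarrow> {v, s v} \<in> edges G"
proof -
  let ?A = "\<lambda>v. nbhd G {v}"
  have "\<exists>D s. D \<subseteq> verts G \<and> card (verts G) \<le> card D + nat (delta 1 G) \<and> inj_on s D \<and> (\<forall>v\<in>D. s v \<in> ?A v)"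
  proof (rule hall_deficiency)
    fix S assume S: "S \<subseteq> verts G"
    have "\<Union>(?A ` S) = nbhd G S" by (auto simp: nbhd_def)
    \<comment> \<open>Passing to \<open>nat\<close> loses nothing: the deficiency is nonnegative, as
      the empty set shows.\<close>
    then show "card S \<le> card (\<Union>(?A ` S)) + nat (delta 1 G)"
      using delta_ge[OF G S, of 1] delta_nonneg[OF G, of 1] by simp
  qed (use finite_verts[OF G] in \<open>auto simp: nbhd_def\<close>)
  then obtain D s where "D \<subseteq> verts G" "card (verts G) \<le> card D + nat (delta 1 G)"
    "inj_on s D" "\<forall>v\<in>D. s v \<in> ?A v"
    by blast
  moreover from this have "{v, s v} \<in> edges G" if "v \<in> D" for v
    using that by (auto simp: nbhd_def)
  ultimately show ?thesis
    using that[of D s] delta_nonneg[OF G, of 1] by (simp add: nat_le_iff)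
qed

section \<open>Bounds on the exponent\<close>

lemma fin_simple_graph_star: "fin_simple_graph (star n)"
  by (auto simp: fin_simple_graph_def star_def)

section \<open>Density estimates for the lower bound\<close>

lemma integral_indicator_box:
  assumes "finite V" "\<And>v. v \<in> V \<Longrightarrow> B v \<in> sets borel" "\<And>v. v \<in> V \<Longrightarrow> B v \<subseteq> {0..1}"
  shows "integrable (cube V) (indicator (PiE V B) :: _ \<Rightarrow> real)"
    and "(\<integral>x. indicator (PiE V B) x \<partial>cube V) = (\<Prod>v\<in>V. measure lborel (B v))"
proof -
  interpret prob_space "cube V" using assms(1) by (rule prob_space_cube)
  have "PiE V B \<in> events" using assms by (rule box_in_sets_cube)
  then show "integrable (cube V) (indicator (PiE V B) :: _ \<Rightarrow> real)"
    by (intro integrable_unit_bounded borel_measurable_indicator) (auto simp: indicator_def)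
  show "(\<integral>x. indicator (PiE V B) x \<partial>cube V) = (\<Prod>v\<in>V. measure lborel (B v))"
    using \<open>PiE V B \<in> events\<close> measure_box[OF assms] sets.sets_into_space[of _ "cube V"]
    by (simp add: Int_absorb2)
qed

text \<open>The exponent \<open>t + 1\<close> balances two ways of placing a star: with its centre
  in the short interval, and with all its \<open>t + 1\<close> vertices in
  \<open>[0, \<epsilon>]\<close>. Both have probability \<open>\<epsilon> ^ (t + 1)\<close>.\<close>

definition core_graphon :: "nat \<Rightarrow> real \<Rightarrow> real \<Rightarrow> real \<Rightarrow> real" where
  "core_graphon t \<epsilon> x y = of_bool (x \<le> \<epsilon> ^ (t + 1) \<or> y \<le> \<epsilon> ^ (t + 1) \<or> (x \<le> \<epsilon> \<and> y \<le> \<epsilon>))"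

lemma graphon_core_graphon: "graphon (core_graphon t \<epsilon>)"
proof -
  have "(\<lambda>p. core_graphon t \<epsilon> (fst p) (snd p)) \<in> borel_measurable (unit_interval \<Otimes>\<^sub>M unit_interval)"
    unfolding core_graphon_def by measurable
  then show ?thesis
    by (auto simp: graphon_def core_graphon_def case_prod_beta')
qed

context
  fixes t :: nat and \<epsilon> :: real
  assumes \<epsilon>: "0 < \<epsilon>" "\<epsilon> < 1"
begin

abbreviation "core \<equiv> core_graphon t \<epsilon>"

lemma core_le: "\<epsilon> ^ (t + 1) \<le> \<epsilon>" "\<epsilon> ^ (t + 1) \<in> {0..1}"
  using \<epsilon> power_decreasing[of 1 "t + 1" \<epsilon>] power_le_one[of \<epsilon> "t + 1"] by simp_all

lemma edge_weight_core:
  assumes "u \<noteq> v" "x u \<in> {0..1}" "x v \<in> {0..1}"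
  shows "edge_weight core x {u, v} = core (x u) (x v)"
  using assms by (intro edge_weight_eq graphon_core_graphon)

text \<open>Vertices in \<open>S - N(S)\<close> are unconstrained because all their neighbours lie in \<open>N(S) - S\<close>.\<close>

lemma hom_density_core_ge:
  fixes G :: "'a sgraph"
  assumes G: "fin_simple_graph G" and "t \<ge> 1"
  shows "\<epsilon> ^ nat (int (card (verts G)) - delta t G) \<le> hom_density G core"
proof -
  obtain S where S: "S \<subseteq> verts G" "delta t G = int (card S) - int t * int (card (nbhd G S))"
    using delta_attained[OF G] .
  let ?N = "nbhd G S"
  have N: "?N \<subseteq> verts G" by (auto simp: nbhd_def)
  note fin = finite_verts[OF G]
  \<comment> \<open>Vertex \<open>v\<close> is confined to an interval of length
    \<open>\<epsilon> ^ c v\<close>; exponent 0 leaves it free.\<close>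
  define c where "c v = (if v \<in> ?N - S then t + 1 else if v \<in> S - ?N then 0 else 1)" for v
  let ?B = "\<lambda>v. {0..\<epsilon> ^ c v}"
  have B1: "\<epsilon> ^ c v \<le> 1" for v using \<epsilon> by (simp add: power_le_one)
  \<comment> \<open>The summands agree except on \<open>S \<inter> ?N\<close>, where 1 is compared
    with \<open>t\<close>; this is where \<open>t \<ge> 1\<close> enters.\<close>
  have "int (\<Sum>v\<in>verts G. c v) \<le> (\<Sum>v\<in>verts G. 1 - of_bool (v \<in> S) + int t * of_bool (v \<in> ?N))"
    unfolding of_nat_sum using \<open>t \<ge> 1\<close> by (intro sum_mono) (auto simp: c_def)
  also have "\<dots> = int (card (verts G)) - (\<Sum>v\<in>verts G. of_bool (v \<in> S))
      + int t * (\<Sum>v\<in>verts G. of_bool (v \<in> ?N))"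
    by (simp add: sum.distrib sum_subtractf sum_distrib_left)
  also have "\<dots> = int (card (verts G)) - delta t G"
    using fin S(1) N by (simp add: S(2) sum.If_cases of_bool_def Int_absorb1)
  finally have "(\<Sum>v\<in>verts G. c v) \<le> nat (int (card (verts G)) - delta t G)" by linarith
  then have "\<epsilon> ^ nat (int (card (verts G)) - delta t G) \<le> \<epsilon> ^ (\<Sum>v\<in>verts G. c v)"
    using \<epsilon> by (intro power_decreasing) auto
  also have "\<dots> = (\<Prod>v\<in>verts G. measure lborel (?B v))"
    using \<epsilon> by (simp add: power_sum)
  also have "\<dots> = (\<integral>x. indicator (PiE (verts G) ?B) x \<partial>cube (verts G))"
    using B1 by (intro integral_indicator_box(2)[symmetric] fin) auto
  also have "\<dots> \<le> hom_density G core"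
    unfolding hom_density_def
  proof (rule integral_mono[OF integral_indicator_box(1) weight_prod_integrable[OF graphon_core_graphon G]])
    fix x assume x: "x \<in> space (cube (verts G))"
    have "(\<Prod>e\<in>edges G. edge_weight core x e) = 1" if xB: "x \<in> PiE (verts G) ?B"
    proof (rule prod.neutral, rule ballI)
      fix e assume e: "e \<in> edges G"
      obtain u v where uv: "e = {u, v}" "u \<noteq> v" "u \<in> verts G" "v \<in> verts G"
        using edgeE[OF G e] .
      have "x u \<le> \<epsilon> ^ c u" "x v \<le> \<epsilon> ^ c v" using xB uv by (auto simp: PiE_iff)
      moreover have "v \<in> ?N" if "u \<in> S" using that e uv by (auto simp: nbhd_def)
      moreover have "u \<in> ?N" if "v \<in> S" using that e uv by (auto simp: nbhd_def insert_commute)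
      \<comment> \<open>If an endpoint lies in \<open>S - ?N\<close>, the other one lies in
        \<open>?N - S\<close>. So the edge either meets \<open>?N - S\<close> or has both ends in
        \<open>[0, \<epsilon>]\<close>.\<close>
      ultimately have "core (x u) (x v) = 1"
        by (auto simp: core_graphon_def c_def split: if_splits)
      then show "edge_weight core x e = 1"
        using edge_weight_core[OF uv(2)] space_cubeD[OF x] uv by simp
    qed
    then show "indicator (PiE (verts G) ?B) x \<le> (\<Prod>e\<in>edges G. edge_weight core x e)"
      using weight_prod_bounds[OF graphon_core_graphon G x] by (auto simp: indicator_def)
  qed (use fin B1 in auto)
  finally show ?thesis .
qed

text \<open>Needed because graphons of density 1 are excluded from the supremum. On the box where
  all coordinates exceed \<open>\<epsilon>\<close>, which has positive measure, every edge weight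
  vanishes.\<close>

lemma hom_density_core_less_1:
  assumes G: "fin_simple_graph G" and "edges G \<noteq> {}"
  shows "hom_density G core < 1"
proof -
  note fin = finite_verts[OF G]
  interpret prob_space "cube (verts G)" using fin by (rule prob_space_cube)
  let ?B = "\<lambda>_. {\<epsilon><..1}"
  have int: "integrable (cube (verts G)) (indicator (PiE (verts G) ?B) :: _ \<Rightarrow> real)"
    and box: "(\<integral>x. indicator (PiE (verts G) ?B) x \<partial>cube (verts G)) = (1 - \<epsilon>) ^ card (verts G)"
    using \<epsilon> integral_indicator_box[OF fin, of ?B] by (simp_all add: subset_iff)
  have "hom_density G core \<le> (\<integral>x. 1 - indicator (PiE (verts G) ?B) x \<partial>cube (verts G))"
    unfolding hom_density_def
  proof (rule integral_mono[OF weight_prod_integrable[OF graphon_core_graphon G]])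
    fix x assume x: "x \<in> space (cube (verts G))"
    have "(\<Prod>e\<in>edges G. edge_weight core x e) = 0" if xB: "x \<in> PiE (verts G) ?B"
    proof -
      obtain e where e: "e \<in> edges G" using assms(2) by blast
      obtain u v where uv: "e = {u, v}" "u \<noteq> v" "u \<in> verts G" "v \<in> verts G"
        using edgeE[OF G e] .
      have "x u > \<epsilon>" "x v > \<epsilon>" using xB uv by (auto simp: PiE_iff)
      then have "core (x u) (x v) = 0" using core_le(1) by (auto simp: core_graphon_def)
      then have "edge_weight core x e = 0"
        using edge_weight_core[OF uv(2)] space_cubeD[OF x] uv by simp
      then show ?thesis using e finite_edges[OF G] by (auto intro: prod_zero)
    qed
    then show "(\<Prod>e\<in>edges G. edge_weight core x e) \<le> 1 - indicator (PiE (verts G) ?B) x"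
      using weight_prod_bounds[OF graphon_core_graphon G x] by (auto simp: indicator_def)
  qed (use int in simp)
  also have "\<dots> = 1 - (1 - \<epsilon>) ^ card (verts G)"
    using int box by (simp add: prob_space)
  also have "\<dots> < 1" using \<epsilon> by simp
  finally show ?thesis .
qed

text \<open>A copy of the star has its centre in \<open>[0, \<epsilon>\<^bsup>t+1\<^esup>]\<close>, or all its vertices in \<open>[0, \<epsilon>]\<close>, or all its
  leaves in \<open>[0, \<epsilon>\<^bsup>t+1\<^esup>]\<close>.\<close>

lemma hom_density_star_core_le:
  assumes "t \<ge> 1"
  shows "hom_density (star t) core \<le> 3 * \<epsilon> ^ (t + 1)"
proof -
  have verts: "verts (star t) = {0..t}" by (simp add: star_def)
  let ?a = "\<epsilon> ^ (t + 1)"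
  \<comment> \<open>Boxes for the three kinds of copies: short interval for the centre, all vertices
    in \<open>[0, \<epsilon>]\<close>, short interval for the leaves.\<close>
  define P Q R :: "nat \<Rightarrow> real set" where "P v = {0..if v = 0 then ?a else 1}"
    and "Q v = {0..\<epsilon>}" and "R v = {0..if v = 0 then 1 else ?a}" for v
  have sub: "P v \<subseteq> {0..1}" "Q v \<subseteq> {0..1}" "R v \<subseteq> {0..1}" for v
    using core_le(2) \<epsilon> by (auto simp: P_def Q_def R_def split: if_splits)
  have borel: "P v \<in> sets borel" "Q v \<in> sets borel" "R v \<in> sets borel" for v
    by (simp_all add: P_def Q_def R_def)
  let ?i = "\<lambda>B x. indicator (PiE {0..t} B) x :: real"
  have int: "integrable (cube {0..t}) (?i P)" "integrable (cube {0..t}) (?i Q)"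
    "integrable (cube {0..t}) (?i R)"
    by (intro integral_indicator_box(1) finite_atLeastAtMost sub borel)+
  have "hom_density (star t) core \<le> (\<integral>x. ?i P x + ?i Q x + ?i R x \<partial>cube {0..t})"
    unfolding hom_density_def verts
  proof (rule integral_mono)
    show "integrable (cube {0..t}) (\<lambda>x. \<Prod>e\<in>edges (star t). edge_weight core x e)"
      using weight_prod_integrable[OF graphon_core_graphon fin_simple_graph_star, of t t] by (simp add: verts)
    show "integrable (cube {0..t}) (\<lambda>x. ?i P x + ?i Q x + ?i R x)"
      using int by simp
    fix x assume x: "x \<in> space (cube {0..t})"
    have x01: "x v \<in> {0..1}" if "v \<le> t" for v using space_cubeD[OF x] that by simp
    have ext: "x \<in> extensional {0..t}" using x by (auto simp: space_PiM PiE_def)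
    have zero: "(\<Prod>e\<in>edges (star t). edge_weight core x e) = 0"
      if "j \<in> {1..t}" "core (x 0) (x j) = 0" for j
    proof -
      have "edge_weight core x {0, j} = 0" using that edge_weight_core[of 0 j x] x01 by simp
      then show ?thesis using that(1) by (auto simp: star_def intro!: prod_zero bexI[of _ "{0, j}"])
    qed
    have "(\<Prod>e\<in>edges (star t). edge_weight core x e) = 0"
      if "x \<notin> PiE {0..t} P" "x \<notin> PiE {0..t} Q" "x \<notin> PiE {0..t} R"
    proof -
      have escape: "\<exists>v\<le>t. x v \<notin> B v" if "x \<notin> PiE {0..t} B" for B
        using that ext by (auto simp: PiE_iff)
      \<comment> \<open>Only the centre is restricted by \<open>P\<close>, and only the leaves are
        restricted by \<open>R\<close>, which tells where \<open>x\<close> leaves these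
        boxes.\<close>
      obtain v where v: "v \<le> t" "x v \<notin> P v" using escape[OF \<open>x \<notin> PiE {0..t} P\<close>] by blast
      then have 0: "x 0 > ?a" using x01[of v] by (auto simp: P_def split: if_splits)
      obtain j where j: "j \<le> t" "x j \<notin> R j" using escape[OF \<open>x \<notin> PiE {0..t} R\<close>] by blast
      then have j': "j \<noteq> 0" "x j > ?a" using x01[of j] by (auto simp: R_def split: if_splits)
      obtain i where "i \<le> t" "x i \<notin> Q i" using escape[OF \<open>x \<notin> PiE {0..t} Q\<close>] by blast
      then have i: "i \<le> t" "x i > \<epsilon>" using x01[of i] by (auto simp: Q_def)
      \<comment> \<open>One missing edge suffices. A centre beyond \<open>\<epsilon>\<close> is not
        joined to the leaf \<open>j\<close> outside the short interval; otherwise the vertex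
        \<open>i\<close> beyond \<open>\<epsilon>\<close> is a leaf, and the centre, being outside
        the short interval, is not joined to it.\<close>
      show ?thesis
      proof (cases "x 0 > \<epsilon>")
        case True
        then show ?thesis using 0 j(1) j' by (intro zero[of j]) (auto simp: core_graphon_def)
      next
        case False
        then have "i \<noteq> 0" using i by (cases "i = 0") auto
        then show ?thesis
          using 0 i core_le(1) by (intro zero[of i]) (auto simp: core_graphon_def)
      qed
    qed
    moreover have "(\<Prod>e\<in>edges (star t). edge_weight core x e) \<in> {0..1}"
      by (rule weight_prod_bounds[OF graphon_core_graphon fin_simple_graph_star]) (simp add: verts x)
    ultimately show "(\<Prod>e\<in>edges (star t). edge_weight core x e) \<le> ?i P x + ?i Q x + ?i R x"
      by (cases "x \<in> PiE {0..t} P"; cases "x \<in> PiE {0..t} Q"; cases "x \<in> PiE {0..t} R") simp_all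
  qed
  also have "\<dots> = (\<integral>x. ?i P x \<partial>cube {0..t}) + (\<integral>x. ?i Q x \<partial>cube {0..t}) + (\<integral>x. ?i R x \<partial>cube {0..t})"
    using int by simp
  also have "\<dots> = (\<Prod>v\<in>{0..t}. measure lborel (P v)) + (\<Prod>v\<in>{0..t}. measure lborel (Q v))
      + (\<Prod>v\<in>{0..t}. measure lborel (R v))"
    by (intro arg_cong2[where f = "(+)"] integral_indicator_box(2) finite_atLeastAtMost sub borel)
  also have "\<dots> = ?a + ?a + ?a ^ t"
  proof -
    have split: "(\<Prod>v\<in>{0..t}. f v) = f 0 * (\<Prod>v\<in>{1..t}. f v)" for f :: "nat \<Rightarrow> real"
      by (simp add: prod.atLeast_Suc_atMost)
    have "(\<Prod>v\<in>{0..t}. measure lborel (P v)) = ?a"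
      unfolding split using \<epsilon> by (simp add: P_def)
    moreover have "(\<Prod>v\<in>{0..t}. measure lborel (Q v)) = ?a"
      using \<epsilon> by (simp add: Q_def)
    moreover have "(\<Prod>v\<in>{0..t}. measure lborel (R v)) = ?a ^ t"
      unfolding split using \<epsilon> by (simp add: R_def)
    ultimately show ?thesis by simp
  qed
  also have "?a ^ t \<le> ?a"
    using core_le(2) assms power_decreasing[of 1 t ?a] by simp
  finally show ?thesis by simp
qed

end

text \<open>The two density estimates at \<open>\<epsilon> = exp (- k)\<close>, where logarithms of
  powers of \<open>\<epsilon>\<close> are linear in \<open>k\<close>. The error term comes from the
  factor 3 in the bound for the star.\<close>

lemma density_domination_exponent_ge_approx:
  assumes "t \<ge> 1" and G: "fin_simple_graph G" and "edges G \<noteq> {}" and "k \<ge> (1::nat)"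
  defines "m \<equiv> real_of_int (int (card (verts G)) - delta t G)"
  shows "ereal (real (t + 1) / m - ln 3 / m / real k) \<le> density_domination_exponent G (star t)"
proof -
  define \<epsilon> where "\<epsilon> = exp (- real k)"
  have \<epsilon>: "0 < \<epsilon>" "\<epsilon> < 1" using assms(4) by (auto simp: \<epsilon>_def)
  have ln_pow: "ln (\<epsilon> ^ n) = - (real n * real k)" for n
    using \<epsilon> by (simp add: ln_realpow \<epsilon>_def)
  let ?W = "core_graphon t \<epsilon>"
  let ?n = "nat (int (card (verts G)) - delta t G)"
  have n: "?n \<ge> 1" "m = real ?n"
    using delta_less_card_verts[OF G assms(3,1)] by (auto simp: m_def)
  define a b where "a = hom_density (star t) ?W" and "b = hom_density G ?W"
  have b: "\<epsilon> ^ ?n \<le> b" "b < 1"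
    using hom_density_core_ge[OF \<epsilon> G assms(1)] hom_density_core_less_1[OF \<epsilon> G assms(3)]
    by (simp_all add: b_def)
  then have b0: "0 < b" using \<epsilon> by (meson less_le_trans zero_less_power)
  have a: "a \<le> 3 * \<epsilon> ^ (t + 1)" "a \<in> {0..1}"
    using hom_density_star_core_le[OF \<epsilon> assms(1)] hom_density_bounds[OF graphon_core_graphon fin_simple_graph_star]
    unfolding a_def by blast+
  have "ereal (real (t + 1) / m - ln 3 / m / real k) \<le> elog a / elog b"
  \<comment> \<open>A star density of 0 makes the quotient infinite, so the bound is
    trivial.\<close>
  proof (cases "a = 0")
    case True
    then show ?thesis using elog_quotient_zero[OF b0 b(2)] by simp
  next
    case False
    then have a0: "a > 0" using a(2) by simp
    have "ln a \<le> ln (3 * \<epsilon> ^ (t + 1))" using a(1) a0 \<epsilon> by simp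
    also have "\<dots> = ln 3 - real (t + 1) * real k"
      using \<epsilon> by (subst ln_mult) (auto simp: ln_pow simp del: power_Suc)
    finally have "real (t + 1) * real k - ln 3 \<le> - ln a" by simp
    moreover have "ln (\<epsilon> ^ ?n) \<le> ln b" using b(1) b0 \<epsilon> by simp
    then have "- ln b \<le> m * real k" by (simp only: ln_pow n(2))
    moreover have "- ln b > 0" using b0 b(2) by simp
    ultimately have "(real (t + 1) * real k - ln 3) / (m * real k) \<le> (- ln a) / (- ln b)"
      using a(2) a0 by (intro frac_le) auto
    also have "(real (t + 1) * real k - ln 3) / (m * real k) = real (t + 1) / m - ln 3 / m / real k"
      using assms(4) n by (simp add: field_simps)
    finally show ?thesis
      using a0 b0 b(2) by (simp add: elog_def)
  qed
  also have "\<dots> \<le> density_domination_exponent G (star t)"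
    unfolding density_domination_exponent_def a_def b_def
    using b b0 graphon_core_graphon[of t \<epsilon>] by (intro SUP_upper) (auto simp: b_def)
  finally show ?thesis .
qed

text \<open>Letting \<open>k\<close> tend to infinity removes the error term.\<close>

lemma density_domination_exponent_star_ge:
  assumes "t \<ge> 1" "fin_simple_graph G" "edges G \<noteq> {}"
  shows "ereal (real (t + 1) / real_of_int (int (card (verts G)) - delta t G))
    \<le> density_domination_exponent G (star t)"
proof (rule LIMSEQ_le_const2)
  let ?m = "real_of_int (int (card (verts G)) - delta t G)"
  have "(\<lambda>k. real (t + 1) / ?m - ln 3 / ?m / real k) \<longlonglongrightarrow> real (t + 1) / ?m - 0"
    by (intro tendsto_diff tendsto_const lim_const_over_n)
  then show "(\<lambda>k. ereal (real (t + 1) / ?m - ln 3 / ?m / real k)) \<longlonglongrightarrow> ereal (real (t + 1) / ?m)"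
    by simp
  show "\<exists>N. \<forall>k\<ge>N. ereal (real (t + 1) / ?m - ln 3 / ?m / real k) \<le> density_domination_exponent G (star t)"
    using density_domination_exponent_ge_approx[OF assms] by blast
qed

section \<open>The matching upper bound for a single edge\<close>

lemma density_domination_exponent_edge_le:
  assumes G: "fin_simple_graph G" and "edges G \<noteq> {}"
  shows "density_domination_exponent G (star 1)
    \<le> ereal (2 / real_of_int (int (card (verts G)) - delta 1 G))"
  unfolding density_domination_exponent_def
proof (rule SUP_least)
  fix W assume "W \<in> {W. graphon W \<and> hom_density G W \<noteq> 0 \<and> hom_density G W \<noteq> 1}"
  then have W: "graphon W" and "hom_density G W \<noteq> 0" "hom_density G W \<noteq> 1" by auto
  let ?m = "real_of_int (int (card (verts G)) - delta 1 G)"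
  define a b where "a = hom_density (star 1) W" and "b = hom_density G W"
  have b: "0 < b" "b < 1"
    using hom_density_bounds[OF W G] \<open>hom_density G W \<noteq> 0\<close> \<open>hom_density G W \<noteq> 1\<close>
    by (auto simp: b_def)
  have a: "a \<in> {0..1}"
    using hom_density_bounds[OF W fin_simple_graph_star] by (simp add: a_def)
  obtain D s where D: "D \<subseteq> verts G" "int (card (verts G)) - delta 1 G \<le> int (card D)" "inj_on s D"
    "\<And>v. v \<in> D \<Longrightarrow> {v, s v} \<in> edges G"
    by (rule partial_matching_exists[OF G]) blast
  have m: "0 < ?m" "?m \<le> real (card D)"
    using delta_less_card_verts[OF G assms(2), of 1] D(2) by linarith+
  have ba: "b \<le> sqrt a ^ card D"
    unfolding a_def b_def by (rule hom_density_le_matching[OF W G D(1,3,4)])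
  \<comment> \<open>The set \<open>D\<close> is nonempty because \<open>?m\<close> is positive, so
    \<open>a = 0\<close> would force \<open>b \<le> 0\<close>.\<close>
  have a0: "a > 0"
  proof (rule ccontr)
    assume "\<not> a > 0"
    then have "sqrt a ^ card D = 0" using a m by (auto simp: zero_power)
    then show False using ba b by linarith
  qed
  have "ln b \<le> ln (sqrt a ^ card D)" using ba b by simp
  also have "\<dots> = real (card D) * (ln a / 2)"
    using a0 by (simp add: ln_realpow ln_sqrt)
  \<comment> \<open>Since \<open>ln a \<le> 0\<close>, replacing \<open>card D\<close> by the
    smaller \<open>?m\<close> increases the product.\<close>
  also have "\<dots> \<le> ?m * (ln a / 2)"
    using m a a0 by (intro mult_right_mono_neg) auto
  finally have "ln a / ln b \<le> 2 / ?m"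
    using m b by (simp add: field_simps)
  then show "elog (hom_density (star 1) W) / elog (hom_density G W) \<le> ereal (2 / ?m)"
    unfolding a_def[symmetric] b_def[symmetric] using a0 b by (simp add: elog_def)
qed

theorem theorem3p3:
  fixes t :: nat and G :: "'a sgraph"
  assumes "t \<ge> 1"
    and "fin_simple_graph G"
    and "edges G \<noteq> {}"
    and "card (verts G) \<ge> t + 1"
  shows "density_domination_exponent G (star t)
           \<ge> ereal (real (t + 1) / real_of_int (int (card (verts G)) - delta t G))
       \<and> (t = 1 \<longrightarrow>
           density_domination_exponent G (star t)
             = ereal (real (t + 1) / real_of_int (int (card (verts G)) - delta t G)))"
  using density_domination_exponent_star_ge[OF assms(1-3)]
    density_domination_exponent_edge_le[OF assms(2,3)]
  by (auto intro!: antisym)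

end
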